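(* Let $X$ be a complex Banach space and let $T:X\to X$ be an invertible bounded linear operator. Then $T$ is hyperbolic if and only if $T$ has the shadowing property and, for every $r>0$, $T$ has no nonzero $r$-homoclinic points.
   Context: Let $X$ be a complex Banach space and $T:X\to X$ an invertible bounded linear operator (with bounded inverse). - $T$ is hyperbolic if $\sigma(T)\cap\mathbb{T}=\varnothing$, where $\sigma(T)$ is the spectrum and $\mathbb{T}=\{z\in\mathbb{C}:|z|=1\}$. - $T$ has the shadowing property if for every $\epsilon>0$ there is $\delta>0$ such that for every sequence $\{x_n\}_{n\in\mathbb{Z}}\subset X$ with $\|T(x_n)-x_{n+1}\|<\delta$ for all $n\in\mathbb{Z}$, there is $x\in X$ with $\|T^n(x)-x_n\|<\epsilon$ for all $n\in\mathbb{Z}$. - For $r>0$, a point $x\in X$ is $r$-homoclinic for $T$ if there is $N\in\mathbb{N}$ such that $\|T^n(x)\|\le r$ for every $n\in\mathbb{Z}$ with $|n|\ge N$. *)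

theory Defs
  imports "HOL-Analysis.Analysis"
begin

(* The distribution has only real normed spaces. A complex normed space is taken
   as a real one together with a complex scalar multiplication that extends the
   real one and for which the norm is absolutely homogeneous. *)
class complex_normed_vector = real_normed_vector +
  fixes scaleC :: "complex \<Rightarrow> 'a \<Rightarrow> 'a"  (infixr "*\<^sub>C" 75)
  assumes scaleC_add_right: "a *\<^sub>C (x + y) = a *\<^sub>C x + a *\<^sub>C y"
    and scaleC_add_left: "(a + b) *\<^sub>C x = a *\<^sub>C x + b *\<^sub>C x"
    and scaleC_scaleC: "a *\<^sub>C b *\<^sub>C x = (a * b) *\<^sub>C x"
    and scaleC_one: "1 *\<^sub>C x = x"
    and scaleR_scaleC: "r *\<^sub>R x = complex_of_real r *\<^sub>C x"
    and norm_scaleC: "norm (a *\<^sub>C x) = cmod a * norm x"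

class complex_banach = complex_normed_vector + complete_space

subclass (in complex_banach) banach ..

instantiation complex :: complex_banach
begin

definition scaleC_complex_def: "scaleC (a::complex) (x::complex) = a * x"

instance
  by standard (simp_all add: scaleC_complex_def algebra_simps norm_mult scaleR_conv_of_real)

end

locale bounded_clinear = bounded_linear f
  for f :: "'a::complex_normed_vector \<Rightarrow> 'b::complex_normed_vector" +
  assumes scaleC: "f (c *\<^sub>C x) = c *\<^sub>C f x"

definition invertible_operator :: "('a::complex_normed_vector \<Rightarrow> 'a) \<Rightarrow> bool" where
  "invertible_operator T \<longleftrightarrow>
     bounded_clinear T \<and> (\<exists>S. bounded_clinear S \<and> S \<circ> T = id \<and> T \<circ> S = id)"

definition spectrum :: "('a::complex_normed_vector \<Rightarrow> 'a) \<Rightarrow> complex set" where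
  "spectrum T = {z. \<not> invertible_operator (\<lambda>x. T x - z *\<^sub>C x)}"

definition hyperbolic :: "('a::complex_normed_vector \<Rightarrow> 'a) \<Rightarrow> bool" where
  "hyperbolic T \<longleftrightarrow> spectrum T \<inter> {z. cmod z = 1} = {}"

definition zpow :: "('a \<Rightarrow> 'a) \<Rightarrow> int \<Rightarrow> 'a \<Rightarrow> 'a" where
  "zpow T n = (if n \<ge> 0 then T ^^ nat n else inv T ^^ nat (- n))"

definition shadowing_property :: "('a::real_normed_vector \<Rightarrow> 'a) \<Rightarrow> bool" where
  "shadowing_property T \<longleftrightarrow>
     (\<forall>\<epsilon>>0. \<exists>\<delta>>0. \<forall>x :: int \<Rightarrow> 'a.
        (\<forall>n. norm (T (x n) - x (n + 1)) < \<delta>) \<longrightarrow>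
        (\<exists>y. \<forall>n. norm (zpow T n y - x n) < \<epsilon>))"

definition homoclinic :: "real \<Rightarrow> ('a::real_normed_vector \<Rightarrow> 'a) \<Rightarrow> 'a \<Rightarrow> bool" where
  "homoclinic r T x \<longleftrightarrow>
     (\<exists>N::nat. \<forall>n::int. \<bar>n\<bar> \<ge> int N \<longrightarrow> norm (zpow T n x) \<le> r)"

end

(* Both conditions on the right say that the operator (u n) |-> (u (n+1) - T (u n)) on bounded
   two-sided sequences is bijective: shadowing is surjectivity with a bound, and the absence of
   homoclinic points is injectivity.

   If it is bijective and |w| = 1, then the unique bounded solution for the right-hand side
   w^n y satisfies u (n+1) = w u n, so w - T is invertible.

   Conversely, no functional calculus is needed. Compactness of the circle bounds (1 - w T)^-1
   uniformly. Averages over the N-th roots of unity w invert 1 - T^N with a uniform bound, and the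
   identity
     sum over w of  w T (1 - w T)^-2  =  N^2 T^N (1 - T^N)^-2
   gives |T^N (1 - T^N)^-2| = O(1/N). With H = (1 - T^N)^-2 and E = T^N H small, one has
   1 = H - 2 E + T^N E. Applied to a bounded orbit this reads
   u n = E (u (n-N)) - 2 E (u n) + E (u (n+N)), which forces u = 0; it also yields an approximate
   Green function, which a Neumann series corrects to an exact one. *)
theory Submission
  imports Defs
begin

section \<open>Complex scalar multiplication\<close>

lemma scaleC_zero_left [simp]: "0 *\<^sub>C (x::'a::complex_normed_vector) = 0"
  by (metis norm_eq_zero norm_scaleC mult_zero_left norm_zero)

lemma scaleC_zero_right [simp]: "a *\<^sub>C (0::'a::complex_normed_vector) = 0"
  by (metis norm_eq_zero norm_scaleC mult_zero_right norm_zero)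

lemma scaleC_sum_left: "(\<Sum>i\<in>I. f i) *\<^sub>C (x::'a::complex_normed_vector) = (\<Sum>i\<in>I. f i *\<^sub>C x)"
  by (induction I rule: infinite_finite_induct) (simp_all add: scaleC_add_left)

lemma scaleC_sum_right: "a *\<^sub>C (\<Sum>i\<in>I. f i :: 'a::complex_normed_vector) = (\<Sum>i\<in>I. a *\<^sub>C f i)"
  by (induction I rule: infinite_finite_induct) (simp_all add: scaleC_add_right)

lemma scaleC_minus_right: "a *\<^sub>C (- x::'a::complex_normed_vector) = - (a *\<^sub>C x)"
  by (metis add.right_inverse add_eq_0_iff scaleC_add_right scaleC_zero_right)

lemma scaleC_diff_right: "a *\<^sub>C (x - y::'a::complex_normed_vector) = a *\<^sub>C x - a *\<^sub>C y"
  by (metis diff_conv_add_uminus scaleC_add_right scaleC_minus_right)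

lemma scaleC_diff_left: "(a - b) *\<^sub>C (x::'a::complex_normed_vector) = a *\<^sub>C x - b *\<^sub>C x"
  by (metis add_diff_cancel diff_add_cancel scaleC_add_left)

section \<open>Roots of unity\<close>

definition unity_root :: "nat \<Rightarrow> nat \<Rightarrow> complex" where
  "unity_root N k = cis (2 * pi * real k / real N)"

lemma cmod_unity_root: "cmod (unity_root N k) = 1"
  by (simp add: unity_root_def)

lemma unity_root_power: "N > 0 \<Longrightarrow> unity_root N k ^ N = 1"
  by (simp add: unity_root_def Complex.DeMoivre)

text \<open>Orthogonality of the characters of Z/N: for fixed \<open>i\<close> the summands are the
  successive powers of one N-th root of unity \<zeta>, so the sum is N if \<zeta> = 1 and (1 -
  \<zeta>^N) / (1 - \<zeta>) = 0 otherwise.\<close>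

lemma sum_powers_unity_root:
  assumes "N > 0"
  shows "(\<Sum>k<N. unity_root N k ^ i) = (if N dvd i then of_nat N else 0)"
proof -
  define \<zeta> where "\<zeta> = cis (2 * pi * real i / real N)"
  have eq: "unity_root N k ^ i = \<zeta> ^ k" for k
    unfolding \<zeta>_def unity_root_def Complex.DeMoivre by (rule arg_cong[of _ _ cis]) (simp add: field_simps)
  have one: "\<zeta> = 1 \<longleftrightarrow> N dvd i"
    using complex_root_unity_eq_1[of N i] assms unfolding \<zeta>_def cis_conv_exp
    by (simp add: mult_ac)
  have "\<zeta> ^ N = 1"
    using assms by (simp add: \<zeta>_def Complex.DeMoivre)
  then show ?thesis
    using one by (simp add: eq sum_gp_strict)
qed

section \<open>Powers of T and finite geometric sums\<close>

locale bounded_clinear_endomorphism = bounded_clinear T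
  for T :: "'a::complex_normed_vector \<Rightarrow> 'a"
begin

lemma linear_funpow: "linear (T ^^ n)"
proof (induction n)
  case (Suc n)
  then show ?case using linear_compose[OF Suc linear_axioms] by (simp add: o_def)
qed (simp add: linear_iff)

lemmas T_funpow_add = linear_add[OF linear_funpow]
  and T_funpow_diff = linear_diff[OF linear_funpow]
  and T_funpow_sum = linear_sum[OF linear_funpow]

lemma funpow_scaleC: "(T ^^ n) (a *\<^sub>C x) = a *\<^sub>C (T ^^ n) x"
  by (induction n) (simp_all add: scaleC)

lemma funpow_T: "(T ^^ n) (T x) = T ((T ^^ n) x)"
  by (simp add: funpow_swap1)

lemma norm_funpow_le: "\<exists>B\<ge>0. \<forall>x. norm ((T ^^ n) x) \<le> B * norm x"
proof (induction n)
  case 0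
  show ?case by (rule exI[of _ 1]) simp
next
  case (Suc n)
  then obtain B where B: "B \<ge> 0" "\<And>x. norm ((T ^^ n) x) \<le> B * norm x" by blast
  obtain K where K: "K \<ge> 0" "\<And>x. norm (T x) \<le> norm x * K"
    using nonneg_bounded by blast
  have "norm ((T ^^ Suc n) x) \<le> (K * B) * norm x" for x
    using K(2)[of "(T ^^ n) x"] mult_left_mono[OF B(2)[of x] K(1)] by (simp add: mult_ac)
  then show ?case using B(1) K(1) by (metis mult_nonneg_nonneg)
qed

definition pow_defect :: "nat \<Rightarrow> 'a \<Rightarrow> 'a" where
  "pow_defect N x = x - (T ^^ N) x"

text \<open>For \<omega>^N = 1 this is the cofactor of 1 - \<omega> T in 1 - T^N. It stands for (1 -
  T^N) (1 - \<omega> T)^-1 without any inverse being formed.\<close>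

definition geo_sum :: "nat \<Rightarrow> complex \<Rightarrow> 'a \<Rightarrow> 'a" where
  "geo_sum N \<omega> x = (\<Sum>j<N. \<omega> ^ j *\<^sub>C (T ^^ j) x)"

lemma linear_pow_defect: "linear (pow_defect N)"
  unfolding pow_defect_def[abs_def] by (intro linear_compose_sub linear_funpow linear_ident)

lemma geo_sum_diff: "geo_sum N \<omega> (x - y) = geo_sum N \<omega> x - geo_sum N \<omega> y"
  by (simp add: geo_sum_def T_funpow_diff scaleC_diff_right sum_subtractf)

lemma geo_sum_T: "geo_sum N \<omega> (T x) = T (geo_sum N \<omega> x)"
  by (simp add: geo_sum_def sum scaleC funpow_T)

lemma geo_sum_scaleC: "geo_sum N \<omega> (a *\<^sub>C x) = a *\<^sub>C geo_sum N \<omega> x"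
  by (simp add: geo_sum_def funpow_scaleC scaleC_sum_right scaleC_scaleC mult.commute)

lemma geo_sum_pow_defect: "geo_sum N \<omega> (pow_defect M x) = pow_defect M (geo_sum N \<omega> x)"
proof -
  have "geo_sum N \<omega> ((T ^^ M) x) = (T ^^ M) (geo_sum N \<omega> x)"
    by (induction M) (simp_all add: geo_sum_T)
  then show ?thesis by (simp add: pow_defect_def geo_sum_diff)
qed

lemma geo_sum_telescope: "geo_sum N \<omega> x - \<omega> *\<^sub>C T (geo_sum N \<omega> x) = x - \<omega> ^ N *\<^sub>C (T ^^ N) x"
proof (induction N)
  case 0
  then show ?case by (simp add: geo_sum_def zero scaleC_one)
next
  case (Suc N)
  have "geo_sum (Suc N) \<omega> x = geo_sum N \<omega> x + \<omega> ^ N *\<^sub>C (T ^^ N) x"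
    by (simp add: geo_sum_def)
  then have "geo_sum (Suc N) \<omega> x - \<omega> *\<^sub>C T (geo_sum (Suc N) \<omega> x) =
      (geo_sum N \<omega> x - \<omega> *\<^sub>C T (geo_sum N \<omega> x)) + \<omega> ^ N *\<^sub>C (T ^^ N) x - \<omega> ^ Suc N *\<^sub>C (T ^^ Suc N) x"
    by (simp add: add scaleC scaleC_add_right scaleC_scaleC)
  with Suc show ?case by simp
qed

text \<open>The two orders of one factorisation: with 1 - \<omega> T outside it transfers norm
  bounds, with 1 - \<omega> T inside it transfers solutions of z - \<omega> T z = x.\<close>

lemma geo_sum_root:
  assumes "\<omega> ^ N = 1"
  shows "geo_sum N \<omega> x - \<omega> *\<^sub>C T (geo_sum N \<omega> x) = pow_defect N x" "geo_sum N \<omega> (x - \<omega> *\<^sub>C T x) = pow_defect N x"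
  using geo_sum_telescope[of N \<omega> x] assms
  by (simp_all add: pow_defect_def scaleC_one geo_sum_diff geo_sum_T geo_sum_scaleC)

text \<open>Orthogonality kills every power except j = 0, the only multiple of N below N. This is
  the averaging formula sum of (1 - \<omega> T)^-1 = N (1 - T^N)^-1, multiplied by 1 - T^N.\<close>

lemma sum_geo_sum:
  assumes "N > 0"
  shows "(\<Sum>k<N. geo_sum N (unity_root N k) x) = of_nat N *\<^sub>C x"
proof -
  have "(\<Sum>k<N. geo_sum N (unity_root N k) x) = (\<Sum>j<N. (\<Sum>k<N. unity_root N k ^ j) *\<^sub>C (T ^^ j) x)"
    unfolding geo_sum_def by (subst sum.swap) (simp add: scaleC_sum_left)
  also have "\<dots> = (\<Sum>j<N. if j = 0 then of_nat N *\<^sub>C x else 0)"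
    using assms by (intro sum.cong) (auto simp: sum_powers_unity_root dest: dvd_imp_le)
  finally show ?thesis using assms by simp
qed

text \<open>The identity for the sum of \<omega> T (1 - \<omega> T)^-2, cleared of denominators. The
  exponents i + j + 1 lie between 1 and 2 N - 1, so only the exponent N survives; it occurs for N
  pairs, each contributing N.\<close>

lemma sum_geo_sum_geo_sum:
  assumes "N > 0"
  shows "(\<Sum>k<N. unity_root N k *\<^sub>C T (geo_sum N (unity_root N k) (geo_sum N (unity_root N k) x))) = of_nat (N * N) *\<^sub>C (T ^^ N) x"
proof -
  have "unity_root N k *\<^sub>C T (geo_sum N (unity_root N k) (geo_sum N (unity_root N k) x)) =
      (\<Sum>i<N. \<Sum>j<N. unity_root N k ^ Suc (i + j) *\<^sub>C (T ^^ Suc (i + j)) x)" for k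
    unfolding geo_sum_def
    by (simp add: sum scaleC scaleC_sum_right scaleC_scaleC T_funpow_sum funpow_scaleC T_funpow_add
        funpow_add power_add mult_ac)
  then have "(\<Sum>k<N. unity_root N k *\<^sub>C T (geo_sum N (unity_root N k) (geo_sum N (unity_root N k) x))) =
      (\<Sum>k<N. \<Sum>i<N. \<Sum>j<N. unity_root N k ^ Suc (i + j) *\<^sub>C (T ^^ Suc (i + j)) x)"
    by simp
  also have "\<dots> = (\<Sum>i<N. \<Sum>j<N. \<Sum>k<N. unity_root N k ^ Suc (i + j) *\<^sub>C (T ^^ Suc (i + j)) x)"
    by (subst sum.swap) (intro sum.cong refl sum.swap)
  also have "\<dots> = (\<Sum>i<N. \<Sum>j<N. if j = N - 1 - i then of_nat N *\<^sub>C (T ^^ N) x else 0)"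
  proof (intro sum.cong refl)
    fix i j assume ij: "i \<in> {..<N}" "j \<in> {..<N}"
    have "N dvd Suc (i + j) \<longleftrightarrow> Suc (i + j) = N"
    proof
      assume "N dvd Suc (i + j)"
      then obtain q where q: "Suc (i + j) = N * q" by (auto elim: dvdE)
      then have "N * q < N * 2" "q \<noteq> 0" using ij by (simp_all flip: q) (use q in \<open>auto intro: ccontr\<close>)
      then have "q = 1" using assms by simp
      with q show "Suc (i + j) = N" by simp
    qed simp
    also have "\<dots> \<longleftrightarrow> j = N - 1 - i" using ij by auto
    finally have dvd: "N dvd Suc (i + j) \<longleftrightarrow> j = N - 1 - i" .
    have "(\<Sum>k<N. unity_root N k ^ Suc (i + j) *\<^sub>C (T ^^ Suc (i + j)) x) =
        (if N dvd Suc (i + j) then of_nat N else 0) *\<^sub>C (T ^^ Suc (i + j)) x"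
      unfolding scaleC_sum_left[symmetric] sum_powers_unity_root[OF assms] ..
    also have "\<dots> = (if j = N - 1 - i then of_nat N *\<^sub>C (T ^^ N) x else 0)"
    proof (cases "j = N - 1 - i")
      case True
      then have "Suc (i + j) = N" using ij by simp
      then show ?thesis using True dvd by simp
    qed (simp only: dvd if_False scaleC_zero_left)
    finally show "(\<Sum>k<N. unity_root N k ^ Suc (i + j) *\<^sub>C (T ^^ Suc (i + j)) x) =
        (if j = N - 1 - i then of_nat N *\<^sub>C (T ^^ N) x else 0)" .
  qed
  also have "\<dots> = (\<Sum>i<N. of_nat N *\<^sub>C (T ^^ N) x)"
    using assms by (intro sum.cong refl) simp
  also have "\<dots> = of_nat (N * N) *\<^sub>C (T ^^ N) x"
    by (simp add: scaleC_scaleC scaleR_scaleC sum_constant_scaleR)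
  finally show ?thesis .
qed

text \<open>\<open>S\<close> is the convolution of \<open>w\<close> with the powers of
  \<open>T\<close>, cut off after N terms. The cutoff leaves one delayed error term, which the later
  Green function has to balance.\<close>

lemma telescoping_sum:
  fixes w :: "int \<Rightarrow> 'a"
  assumes S: "\<And>m. S m = (\<Sum>j<N. (T ^^ j) (w (m - 1 - int j)))"
  shows "S (m + 1) - T (S m) = w m - (T ^^ N) (w (m - int N))"
proof -
  have "S (m + 1) - T (S m) =
      (\<Sum>j<N. (T ^^ j) (w (m - int j)) - (T ^^ Suc j) (w (m - int (Suc j))))"
    by (simp add: S sum sum_subtractf algebra_simps)
  also have "\<dots> = w m - (T ^^ N) (w (m - int N))"
    by (subst sum_lessThan_telescope') simp
  finally show ?thesis .
qed

lemma norm_sum_funpow_le: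
  obtains B where "B \<ge> 0"
    "\<And>w b. (\<And>j. norm (w j) \<le> b) \<Longrightarrow> norm (\<Sum>j<N. (T ^^ j) (w j)) \<le> B * b"
proof -
  have "\<exists>B. B \<ge> 0 \<and> (\<forall>x. norm ((T ^^ j) x) \<le> B * norm x)" for j
    using norm_funpow_le[of j] by blast
  then obtain B where B: "\<And>j. B j \<ge> 0" "\<And>j x. norm ((T ^^ j) x) \<le> B j * norm x"
    by metis
  show thesis
  proof (rule that[of "\<Sum>j<N. B j"])
    show "(\<Sum>j<N. B j) \<ge> 0" using B by (simp add: sum_nonneg)
    show "norm (\<Sum>j<N. (T ^^ j) (w j)) \<le> (\<Sum>j<N. B j) * b" if w: "\<And>j. norm (w j) \<le> b" for w b
      unfolding sum_distrib_right
      using order_trans[OF B(2) mult_left_mono[OF w B(1)]] by (intro sum_norm_le)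
  qed
qed

end

section \<open>Uniform resolvent bounds on the circle\<close>

text \<open>Expresses that every 1 - \<omega> T with \<omega> on the circle has an inverse of norm
  at most 1/c, by a lower bound and surjectivity, so that no inverse has to be named.\<close>

locale uniform_circle_resolvent = bounded_clinear_endomorphism T
  for T :: "'a::complex_normed_vector \<Rightarrow> 'a" +
  fixes c :: real
  assumes c_pos: "c > 0"
    and lower: "cmod \<omega> = 1 \<Longrightarrow> c * norm x \<le> norm (x - \<omega> *\<^sub>C T x)"
    and onto: "cmod \<omega> = 1 \<Longrightarrow> \<exists>z. z - \<omega> *\<^sub>C T z = x"
begin

text \<open>The bound holds for each term of the average over roots of unity, hence for the average.
  The constant is the same for all N, which is what allows N to be chosen large later.\<close>

lemma pow_defect_lower:
  assumes "N > 0"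
  shows "c * norm x \<le> norm (pow_defect N x)"
proof -
  have "c * norm (geo_sum N (unity_root N k) x) \<le> norm (pow_defect N x)" for k
    using lower[OF cmod_unity_root, of "geo_sum N (unity_root N k) x" N k] geo_sum_root(1)[OF unity_root_power[OF assms]] by simp
  then have "(\<Sum>k<N. c * norm (geo_sum N (unity_root N k) x)) \<le> real N * norm (pow_defect N x)"
    by (metis (no_types, lifting) sum_bounded_above card_lessThan)
  moreover have "real N * norm x \<le> (\<Sum>k<N. norm (geo_sum N (unity_root N k) x))"
    using norm_sum[of "\<lambda>k. geo_sum N (unity_root N k) x" "{..<N}"] by (simp add: sum_geo_sum[OF assms] norm_scaleC)
  ultimately have "c * (real N * norm x) \<le> real N * norm (pow_defect N x)"
    using mult_left_mono[of "real N * norm x" _ c, OF _ less_imp_le[OF c_pos]]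
    unfolding sum_distrib_left[symmetric] by fastforce
  then show ?thesis using assms by (simp add: mult.left_commute)
qed

text \<open>The preimage is the average of the solutions of z - \<omega> T z = x over the N-th roots
  of unity \<omega>.\<close>

lemma pow_defect_onto:
  assumes "N > 0"
  shows "\<exists>z. pow_defect N z = x"
proof -
  obtain z where z: "\<And>k. z k - unity_root N k *\<^sub>C T (z k) = x"
    using onto[of "unity_root N _" x] by (metis cmod_unity_root)
  have "pow_defect N (z k) = geo_sum N (unity_root N k) x" for k
    using geo_sum_root(2)[OF unity_root_power[OF assms], of k "z k"] z[of k] by simp
  then have "pow_defect N (\<Sum>k<N. z k) = (\<Sum>k<N. geo_sum N (unity_root N k) x)"
    by (simp add: linear_sum[OF linear_pow_defect])
  then have "pow_defect N (inverse (real N) *\<^sub>R (\<Sum>k<N. z k)) = inverse (real N) *\<^sub>R (of_nat N *\<^sub>C x)"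
    by (simp add: linear_scale[OF linear_pow_defect] sum_geo_sum[OF assms])
  also have "\<dots> = x" using assms by (simp add: scaleR_scaleC scaleC_scaleC scaleC_one)
  finally show ?thesis ..
qed

text \<open>Two uses of \<open>lower\<close> bound each of the N terms in
  \<open>sum_geo_sum_geo_sum\<close>, whose total carries the factor N^2; the quotient is the gain
  of 1/N.\<close>

lemma norm_funpow_le_pow_defect:
  assumes "N > 0" "K \<ge> 0" "\<And>x. norm (T x) \<le> norm x * K"
  shows "real N * (c\<^sup>2 * norm ((T ^^ N) y)) \<le> K * norm (pow_defect N (pow_defect N y))"
proof -
  have "c\<^sup>2 * norm (T (geo_sum N (unity_root N k) (geo_sum N (unity_root N k) y))) \<le> K * norm (pow_defect N (pow_defect N y))" for k
  proof -
    let ?P = "geo_sum N (unity_root N k)"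
    note R = geo_sum_root[OF unity_root_power[OF assms(1)]]
    have "c * norm (?P (?P y)) \<le> norm (pow_defect N (?P y))"
      using lower[OF cmod_unity_root, of "?P (?P y)" N k] R(1) by simp
    moreover have "c * norm (?P (pow_defect N y)) \<le> norm (pow_defect N (pow_defect N y))"
      using lower[OF cmod_unity_root, of "?P (pow_defect N y)" N k] R(1) by simp
    ultimately have "c\<^sup>2 * norm (?P (?P y)) \<le> norm (pow_defect N (pow_defect N y))"
      using mult_left_mono[of "c * norm (?P (?P y))" "norm (pow_defect N (?P y))" c, OF _ less_imp_le[OF c_pos]]
      unfolding geo_sum_pow_defect power2_eq_square mult.assoc by linarith
    from mult_right_mono[OF this assms(2)]
      mult_left_mono[OF assms(3)[of "?P (?P y)"], of "c\<^sup>2"]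
    show ?thesis by (simp add: mult_ac)
  qed
  then have "(\<Sum>k<N. c\<^sup>2 * norm (T (geo_sum N (unity_root N k) (geo_sum N (unity_root N k) y)))) \<le> real N * (K * norm (pow_defect N (pow_defect N y)))"
    by (metis (no_types, lifting) sum_bounded_above card_lessThan)
  moreover have "real (N * N) * norm ((T ^^ N) y) \<le> (\<Sum>k<N. norm (T (geo_sum N (unity_root N k) (geo_sum N (unity_root N k) y))))"
    using norm_sum[of "\<lambda>k. unity_root N k *\<^sub>C T (geo_sum N (unity_root N k) (geo_sum N (unity_root N k) y))" "{..<N}"]
    unfolding sum_geo_sum_geo_sum[OF assms(1)] norm_scaleC cmod_unity_root by (simp add: norm_mult cmod_unity_root)
  then have "c\<^sup>2 * (real (N * N) * norm ((T ^^ N) y)) \<le> (\<Sum>k<N. c\<^sup>2 * norm (T (geo_sum N (unity_root N k) (geo_sum N (unity_root N k) y))))"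
    unfolding sum_distrib_left[symmetric] by (rule mult_left_mono) simp
  ultimately have "real N * (real N * (c\<^sup>2 * norm ((T ^^ N) y))) \<le> real N * (K * norm (pow_defect N (pow_defect N y)))"
    by (simp add: mult_ac)
  then show ?thesis using assms(1) by simp
qed

text \<open>
  \<open>H = (1 - T\<^sup>N)\<^sup>-\<^sup>2\<close> is close to the spectral projection belonging to the open unit
  disc, and \<open>T\<^sup>N H\<close> measures how far it is from being one.
\<close>
lemma almost_projection:
  obtains N H C where "N > 0" "linear H" "\<And>x. H (T x) = T (H x)" "\<And>x. norm (H x) \<le> C * norm x"
    "\<And>x. H x - 2 *\<^sub>R (T ^^ N) (H x) + (T ^^ N) ((T ^^ N) (H x)) = x"
    "\<And>x. norm ((T ^^ N) (H x)) \<le> norm x / 8"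
proof -
  obtain K where K: "K \<ge> 0" "\<And>x. norm (T x) \<le> norm x * K"
    using nonneg_bounded by blast
  \<comment> \<open>N is taken so large that K / (N c^2) is at most 1/8, the smallness required of
    T^N H.\<close>
  obtain N where N: "8 * K / c\<^sup>2 < real N"
    using reals_Archimedean2 by blast
  moreover have "8 * K / c\<^sup>2 \<ge> 0" using K(1) by simp
  ultimately have N0: "N > 0" by (metis of_nat_0_less_iff order.strict_trans1)
  have N8: "8 * K \<le> real N * c\<^sup>2"
    using N c_pos by (simp add: field_simps)
  have "\<exists>z. pow_defect N (pow_defect N z) = x" for x
    using pow_defect_onto[OF N0] by metis
  then obtain H where H: "\<And>x. pow_defect N (pow_defect N (H x)) = x" by metis
  \<comment> \<open>This bounds \<open>H\<close>, and it makes (1 - T^N)^2 injective, so that the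
    algebraic properties of \<open>H\<close> can be checked after applying (1 - T^N)^2.\<close>
  have DD: "c\<^sup>2 * norm x \<le> norm (pow_defect N (pow_defect N x))" for x
    using pow_defect_lower[OF N0, of "pow_defect N x"]
      mult_left_mono[OF pow_defect_lower[OF N0, of x] less_imp_le[OF c_pos]]
    unfolding power2_eq_square mult.assoc by linarith
  have lin: "linear (pow_defect N \<circ> pow_defect N)" by (intro linear_compose linear_pow_defect)
  have inj: "pow_defect N (pow_defect N x) = pow_defect N (pow_defect N y) \<Longrightarrow> x = y" for x y
    using DD[of "x - y"] c_pos linear_diff[OF lin, of x y] by (simp add: mult_le_0_iff)
  have DT: "pow_defect N (T x) = T (pow_defect N x)" for x by (simp add: pow_defect_def diff funpow_T)
  show thesis
  proof (rule that[of N H "inverse (c\<^sup>2)"])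
    show "linear H"
    proof (rule linearI)
      show "H (x + y) = H x + H y" for x y
        by (rule inj) (simp add: linear_add[OF linear_pow_defect] H)
      show "H (r *\<^sub>R x) = r *\<^sub>R H x" for r x
        by (rule inj) (simp add: linear_scale[OF linear_pow_defect] H)
    qed
    show "H (T x) = T (H x)" for x by (rule inj) (simp add: H DT)
    show "norm (H x) \<le> inverse (c\<^sup>2) * norm x" for x
      using DD[of "H x"] c_pos by (simp add: H field_simps)
    show "H x - 2 *\<^sub>R (T ^^ N) (H x) + (T ^^ N) ((T ^^ N) (H x)) = x" for x
      using H[of x] unfolding pow_defect_def T_funpow_diff scaleR_2 by (simp add: algebra_simps)
    show "norm ((T ^^ N) (H x)) \<le> norm x / 8" for x
    proof -
      show ?thesis
      proof (cases "K = 0")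
        \<comment> \<open>The estimate cannot be divided by K = 0, but then T = 0 and T^N = 0
          because N > 0.\<close>
        case True
        with K(2) have "T y = 0" for y using K(2)[of y] by simp
        then have "(T ^^ N) y = 0" for y using N0 by (cases N) simp_all
        then show ?thesis by simp
      next
        case False
        have "8 * K * norm ((T ^^ N) (H x)) \<le> (real N * c\<^sup>2) * norm ((T ^^ N) (H x))"
          by (rule mult_right_mono[OF N8]) simp
        also have "\<dots> \<le> K * norm x"
          using norm_funpow_le_pow_defect[OF N0 K, of "H x"] by (simp add: H mult_ac)
        finally show ?thesis using False K(1) by (simp add: field_simps)
      qed
    qed
  qed fact
qed

end

section \<open>A Neumann series for bounded sequences\<close>

text \<open>On bounded sequences the perturbation of the identity has norm at most (2 + 1 + 1) / 8 =
  1/2, so the Neumann series converges and at most doubles the bound. The series is summed at each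
  index separately.\<close>

lemma ex_bounded_two_step_Neumann:
  fixes E :: "'a::banach \<Rightarrow> 'a"
  assumes "linear E" and E: "\<And>x. norm (E x) \<le> norm x / 8"
    and z: "\<And>n. norm (z n) \<le> b"
  shows "\<exists>w. (\<forall>n::int. w n + 2 *\<^sub>R E (w n) - E (w (n - k)) - E (w (n + k)) = z n) \<and>
             (\<forall>n. norm (w n) \<le> 2 * b)"
proof -
  interpret linear E by fact
  have est: "norm (E y + E v - 2 *\<^sub>R E x) \<le> a / 2"
    if "norm x \<le> a" "norm y \<le> a" "norm v \<le> a" for x y v a
  proof -
    have "norm (E y + E v - 2 *\<^sub>R E x) \<le> norm (E y) + norm (E v) + 2 * norm (E x)"
      using norm_triangle_ineq4[of "E y + E v" "2 *\<^sub>R E x"] norm_triangle_ineq[of "E y" "E v"]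
      by simp
    with that E[of x] E[of y] E[of v] show ?thesis by linarith
  qed
  have bl: "bounded_linear E"
    by (rule bounded_linear_intro[of E "1/8"]) (use E in \<open>simp_all add: add scale\<close>)
  \<comment> \<open>\<open>f j\<close> is the j-th term of the series: the negated perturbation
    applied j times to \<open>z\<close>.\<close>
  define f where "f = rec_nat z (\<lambda>_ g n. E (g (n - k)) + E (g (n + k)) - 2 *\<^sub>R E (g n))"
  have f_0: "f 0 = z"
    and f_Suc: "f (Suc j) n = E (f j (n - k)) + E (f j (n + k)) - 2 *\<^sub>R E (f j n)" for j n
    by (simp_all add: f_def)
  have f_le: "norm (f j n) \<le> b * (1/2) ^ j" for j n
  proof (induction j arbitrary: n)
    case (Suc j)
    show ?case unfolding f_Suc using est[OF Suc Suc Suc, of "n - k" "n + k" n] by simp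
  qed (simp add: f_0 z)
  have geo: "summable (\<lambda>j. b * (1/2) ^ j)" "(\<Sum>j. b * (1/2) ^ j) = 2 * b"
    using suminf_geometric[of "1/2::real"]
    by (simp_all add: summable_mult summable_geometric suminf_mult)
  have sm: "summable (\<lambda>j. f j n)" for n
    by (rule summable_comparison_test[OF _ geo(1)]) (use f_le in blast)
  define w where "w n = (\<Sum>j. f j n)" for n
  have "norm (w n) \<le> 2 * b" for n
    unfolding w_def geo(2)[symmetric] by (rule norm_suminf_le[OF f_le geo(1)])
  moreover have "w n + 2 *\<^sub>R E (w n) - E (w (n - k)) - E (w (n + k)) = z n" for n
  proof -
    have Ew: "(\<lambda>j. E (f j m)) sums E (w m)" for m
      unfolding w_def by (rule bounded_linear.sums[OF bl summable_sums[OF sm]])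
    have "(\<lambda>j. f (Suc j) n) sums (E (w (n - k)) + E (w (n + k)) - 2 *\<^sub>R E (w n))"
      unfolding f_Suc by (intro sums_diff sums_add sums_scaleR_right Ew)
    moreover have "(\<lambda>j. f (Suc j) n) sums (w n - z n)"
      using sums_Suc_iff[of "\<lambda>j. f j n" "w n - z n"] summable_sums[OF sm, of n]
      by (simp add: f_0 w_def)
    ultimately have "w n - z n = E (w (n - k)) + E (w (n + k)) - 2 *\<^sub>R E (w n)"
      by (rule sums_unique2[rotated])
    then show ?thesis by (simp add: algebra_simps)
  qed
  ultimately show ?thesis by blast
qed

section \<open>Uniqueness of bounded orbits\<close>

context uniform_circle_resolvent
begin

text \<open>Every bound on the orbit can be halved, so its supremum s satisfies s \<le> s /
  2.\<close>

lemma bounded_orbit_eq_0: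
  fixes u :: "int \<Rightarrow> 'a"
  assumes orbit: "\<And>n. u (n + 1) = T (u n)" and bdd: "\<And>n. norm (u n) \<le> b"
  shows "u n = 0"
proof -
  obtain N H where H: "linear H" "\<And>x. H (T x) = T (H x)"
    and id: "\<And>x. H x - 2 *\<^sub>R (T ^^ N) (H x) + (T ^^ N) ((T ^^ N) (H x)) = x"
    and small: "\<And>x. norm ((T ^^ N) (H x)) \<le> norm x / 8"
    by (rule almost_projection) blast
  have HT: "H ((T ^^ j) x) = (T ^^ j) (H x)" for j x
    by (induction j) (simp_all add: H(2))
  have iter: "u (m + int j) = (T ^^ j) (u m)" for m j
  proof (induction j)
    case (Suc j)
    have "u (m + int (Suc j)) = u ((m + int j) + 1)" by (simp add: add_ac)
    with Suc show ?case by (simp only: orbit) simp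
  qed simp
  have half: "norm (u m) \<le> a / 2" if a: "\<And>m. norm (u m) \<le> a" for a m
  proof -
    let ?E = "\<lambda>x. (T ^^ N) (H x)"
    \<comment> \<open>Shifting the orbit by N absorbs T^N: the term in \<open>H\<close> is read off
      the past and the term in T^(2N) \<open>H\<close> off the future, so that only the small
      operator T^N \<open>H\<close> remains.\<close>
    have "H (u m) = ?E (u (m - int N))"
      using iter[of "m - int N" N] by (simp add: HT)
    moreover have "(T ^^ N) (?E (u m)) = ?E (u (m + int N))"
      by (simp add: iter HT)
    ultimately have "u m = ?E (u (m - int N)) - 2 *\<^sub>R ?E (u m) + ?E (u (m + int N))"
      using id[of "u m"] by simp
    then have "norm (u m) \<le> norm (?E (u (m - int N))) + 2 * norm (?E (u m)) + norm (?E (u (m + int N)))"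
      using norm_triangle_ineq[of "?E (u (m - int N)) - 2 *\<^sub>R ?E (u m)" "?E (u (m + int N))"]
        norm_triangle_ineq4[of "?E (u (m - int N))" "2 *\<^sub>R ?E (u m)"] by simp
    with small[of "u (m - int N)"] small[of "u m"] small[of "u (m + int N)"]
      a[of "m - int N"] a[of m] a[of "m + int N"]
    show ?thesis by linarith
  qed
  define s where "s = (SUP m. norm (u m))"
  have "norm (u m) \<le> s" for m
    unfolding s_def by (rule cSUP_upper) (auto intro: bdd_aboveI2[of UNIV _ b] bdd)
  then have "norm (u m) \<le> s / 2" for m by (rule half)
  then have "s \<le> s / 2"
    unfolding s_def by (intro cSUP_least) auto
  with \<open>norm (u n) \<le> s\<close> show ?thesis by (smt (verit) norm_le_zero_iff field_sum_of_halves)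
qed

end

section \<open>Bounded solutions of the inhomogeneous equation\<close>

locale banach_uniform_circle_resolvent = uniform_circle_resolvent T c
  for T :: "'a::complex_banach \<Rightarrow> 'a" and c
begin

text \<open>Replacing \<open>z\<close> by the corrected sequence \<open>w\<close> turns an
  approximate Green function into an exact one. That \<open>C\<close> is chosen before
  \<open>z\<close> and \<open>b\<close> later makes \<delta> proportional to \<epsilon>.\<close>

lemma bounded_solution:
  obtains C where "C \<ge> 0"
    "\<And>z b. (\<And>n. norm (z n) \<le> b) \<Longrightarrow>
      \<exists>v. (\<forall>n::int. v (n + 1) - T (v n) = z n) \<and> (\<forall>n. norm (v n) \<le> C * b)"
proof -
  obtain N H C where H: "linear H" "\<And>x. H (T x) = T (H x)" "\<And>x. norm (H x) \<le> C * norm x"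
    and id: "\<And>x. H x - 2 *\<^sub>R (T ^^ N) (H x) + (T ^^ N) ((T ^^ N) (H x)) = x"
    and small: "\<And>x. norm ((T ^^ N) (H x)) \<le> norm x / 8"
    by (rule almost_projection) blast
  have HT: "H ((T ^^ j) x) = (T ^^ j) (H x)" for j x
    by (induction j) (simp_all add: H(2))
  define E where "E x = (T ^^ N) (H x)" for x
  have linE: "linear E"
    using linear_compose[OF H(1) linear_funpow[of N]] by (simp add: o_def E_def[abs_def])
  have ET: "E (T x) = T (E x)" for x by (simp add: E_def H funpow_T)
  obtain B where B: "B \<ge> 0"
    "\<And>w b. (\<And>j. norm (w j) \<le> b) \<Longrightarrow> norm (\<Sum>j<N. (T ^^ j) (w j)) \<le> B * b"
    using norm_sum_funpow_le by blast
  show thesis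
  \<comment> \<open>The factor 2 \<open>B\<close> bounds \<open>S\<close>, since \<open>w\<close> is
    bounded by 2 \<open>b\<close>; the absolute value of \<open>C\<close> accounts for
    \<open>H\<close> and the 1 for \<open>E\<close>.\<close>
  proof (rule that[of "(\<bar>C\<bar> + 1) * (2 * B)"])
    show "(\<bar>C\<bar> + 1) * (2 * B) \<ge> 0" using B(1) by simp
    fix z :: "int \<Rightarrow> 'a" and b assume z: "\<And>n. norm (z n) \<le> b"
    have small_E: "\<And>x. norm (E x) \<le> norm x / 8" using small by (simp add: E_def)
    obtain w where w: "\<And>n. w n + 2 *\<^sub>R E (w n) - E (w (n - int N)) - E (w (n + int N)) = z n"
      and w_le: "\<And>n. norm (w n) \<le> 2 * b"
      using ex_bounded_two_step_Neumann[OF linE small_E, of z b "int N", OF z] by blast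
    \<comment> \<open>Up to the small correction absorbed by \<open>w\<close>, \<open>v\<close> is the convolution of \<open>w\<close> with the Green
      function that is \<open>T\<^sup>n\<^sup>-\<^sup>1 H\<close> for \<open>1 \<le> n \<le> N\<close>, \<open>- T\<^sup>n\<^sup>+\<^sup>N\<^sup>-\<^sup>1 E\<close> for \<open>- N < n \<le> 0\<close>,
      and \<open>0\<close> elsewhere.\<close>
    define S where "S m = (\<Sum>j<N. (T ^^ j) (w (m - 1 - int j)))" for m
    define v where "v m = H (S m) - E (S (m + int N))" for m
    have S: "S (m + 1) - T (S m) = w m - (T ^^ N) (w (m - int N))" for m
      by (rule telescoping_sum[OF S_def])
    have "v (m + 1) - T (v m) = z m" for m
    proof -
      have "v (m + 1) - T (v m) = H (S (m + 1) - T (S m)) - E (S (m + int N + 1) - T (S (m + int N)))"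
        by (simp add: v_def linear_diff[OF H(1)] linear_diff[OF linE] diff H(2) ET add_ac)
      \<comment> \<open>The cutoff errors are T^N H w(m - N) = E w(m - N) and T^N E w(m). The next
        step uses H + T^N E = 1 + 2 E.\<close>
      also have "\<dots> = H (w m) - E (w (m - int N)) - E (w (m + int N)) + (T ^^ N) (E (w m))"
        unfolding S by (simp add: linear_diff[OF H(1)] linear_diff[OF linE] HT E_def T_funpow_diff)
      also have "\<dots> = w m + 2 *\<^sub>R E (w m) - E (w (m - int N)) - E (w (m + int N))"
        using id[of "w m"] unfolding E_def by (simp add: algebra_simps)
      finally show ?thesis by (simp add: w)
    qed
    moreover have "norm (v m) \<le> (\<bar>C\<bar> + 1) * (2 * B) * b" for m
    proof -
      have S_le: "norm (S m) \<le> B * (2 * b)" for m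
        unfolding S_def by (rule B(2)) (rule w_le)
      have "norm (H (S m)) \<le> \<bar>C\<bar> * (B * (2 * b))"
        using order_trans[OF H(3) mult_mono[OF abs_ge_self S_le]] by simp
      moreover have "norm (E (S (m + int N))) \<le> B * (2 * b)"
        using small_E[of "S (m + int N)"] S_le[of "m + int N"] norm_ge_zero[of "S (m + int N)"]
        by linarith
      ultimately have "norm (v m) \<le> \<bar>C\<bar> * (B * (2 * b)) + B * (2 * b)"
        unfolding v_def by (rule norm_triangle_le_diff[OF add_mono])
      then show ?thesis by (simp add: algebra_simps)
    qed
    ultimately show "\<exists>v. (\<forall>n. v (n + 1) - T (v n) = z n) \<and>
        (\<forall>n. norm (v n) \<le> (\<bar>C\<bar> + 1) * (2 * B) * b)" by blast
  qed
qed

end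

section \<open>Two-sided orbits and pseudo-orbits\<close>

lemma zpow_Suc:
  assumes "surj T"
  shows "zpow T (n + 1) x = T (zpow T n x)"
proof (cases "n \<ge> 0")
  case True
  then show ?thesis by (simp add: zpow_def nat_add_distrib)
next
  case False
  then obtain k where k: "n = - int (Suc k)"
    by (metis nat_eq_iff2 neg_int_cases not_le Suc_pred')
  have "nat (- n) = Suc k" "nat (- (n + 1)) = k" using k by auto
  \<comment> \<open>For k = 0 the step leads from -1 to 0, where \<open>zpow\<close> switches from
    powers of \<open>inv T\<close> to powers of \<open>T\<close>.\<close>
  then show ?thesis
    using False k surj_f_inv_f[OF assms] by (cases "k = 0") (simp_all add: zpow_def)
qed

lemma zpow_0: "zpow T 0 x = x"
  by (simp add: zpow_def)

lemma orbit_eq_zpow: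
  assumes "bij T" and u: "\<And>n::int. u (n + 1) = T (u n)"
  shows "u n = zpow T n (u 0)"
proof (induction n rule: int_induct[where k = 0])
  case (step2 i)
  have "T (u (i - 1)) = T (zpow T (i - 1) (u 0))"
    using u[of "i - 1"] zpow_Suc[OF bij_is_surj[OF assms(1)], of "i - 1" "u 0"] step2 by simp
  then show ?case using bij_is_inj[OF assms(1)] by (simp add: inj_eq)
qed (simp_all add: zpow_0 u zpow_Suc[OF bij_is_surj[OF assms(1)]])

text \<open>The recursion is solved from the value 0 at index 0, forwards by \<open>T\<close> and
  backwards by \<open>inv T\<close>, with no control of the size. It turns a prescribed error
  \<open>z\<close> into a pseudo-orbit to which shadowing applies.\<close>

lemma ex_pseudo_orbit:
  fixes z :: "int \<Rightarrow> 'a::ab_group_add"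
  assumes "surj T"
  obtains x where "\<And>n. x (n + 1) - T (x n) = z n"
proof -
  define f where "f = rec_nat 0 (\<lambda>k y. T y + z (int k))"
  \<comment> \<open>\<open>g k\<close> is the value at index -k, so passing to
    \<open>g (Suc k)\<close> solves the equation at index -(k + 1). Both recursions give 0 at index
    0.\<close>
  define g where "g = rec_nat 0 (\<lambda>k y. inv T (y - z (- int (Suc k))))"
  define x where "x n = (if n \<ge> 0 then f (nat n) else g (nat (- n)))" for n :: int
  have g: "g k - T (g (Suc k)) = z (- int (Suc k))" for k
    by (simp add: g_def surj_f_inv_f[OF assms])
  have "x (n + 1) - T (x n) = z n" for n
  proof (cases "n \<ge> 0")
    case True
    then show ?thesis by (simp add: x_def f_def nat_add_distrib)
  next
    case False
    then obtain k where k: "n = - int (Suc k)"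
      by (metis nat_eq_iff2 neg_int_cases not_le Suc_pred')
    have "nat (- n) = Suc k" using k by simp
    moreover have "x (n + 1) = g k"
    proof (cases k)
      case (Suc l)
      then have "nat (- (n + 1)) = k" "\<not> n + 1 \<ge> 0" using k by simp_all
      then show ?thesis by (simp add: x_def)
    qed (use k in \<open>simp add: x_def f_def g_def\<close>)
    ultimately show ?thesis using g[of k] k False by (simp add: x_def)
  qed
  then show thesis by (rule that)
qed

section \<open>Invertible operators and the compactness of the circle\<close>

lemma invertible_operatorD:
  assumes "invertible_operator A"
  shows "bounded_clinear A" "bij A" "\<exists>K>0. \<forall>x. norm x \<le> K * norm (A x)"
proof -
  obtain S where S: "bounded_clinear A" "bounded_clinear S" "S \<circ> A = id" "A \<circ> S = id"
    using assms unfolding invertible_operator_def by blast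
  then show "bounded_clinear A" "bij A" by (auto intro: o_bij)
  interpret S: bounded_clinear S by fact
  obtain K where "K > 0" "\<And>y. norm (S y) \<le> norm y * K" using S.pos_bounded by blast
  moreover have "S (A x) = x" for x using S(3) by (metis comp_apply id_apply)
  ultimately show "\<exists>K>0. \<forall>x. norm x \<le> K * norm (A x)" by (metis mult.commute)
qed

text \<open>The estimate on solutions bounds the inverse directly; its linearity is pulled back
  along the injective \<open>A\<close>.\<close>

lemma invertible_operatorI:
  assumes "bounded_clinear A" and ker: "\<And>x. A x = 0 \<Longrightarrow> x = 0"
    and solve: "\<And>y. \<exists>x. A x = y \<and> norm x \<le> K * norm y"
  shows "invertible_operator A"
proof -
  interpret A: bounded_clinear A by fact
  have inj: "A x = A y \<Longrightarrow> x = y" for x y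
    using ker[of "x - y"] by (simp add: A.diff)
  obtain S where S: "\<And>y. A (S y) = y" "\<And>y. norm (S y) \<le> K * norm y"
    using solve by metis
  have "bounded_clinear S"
  proof (unfold_locales)
    show "S (x + y) = S x + S y" for x y by (rule inj) (simp add: A.add S)
    show "S (r *\<^sub>R x) = r *\<^sub>R S x" for r x by (rule inj) (simp add: A.scaleR S)
    show "S (a *\<^sub>C x) = a *\<^sub>C S x" for a x by (rule inj) (simp add: A.scaleC S)
    show "\<exists>K. \<forall>x. norm (S x) \<le> norm x * K"
      using S(2) by (metis mult.commute)
  qed
  moreover have "S \<circ> A = id" "A \<circ> S = id"
    using S(1) inj by auto
  ultimately show ?thesis
    using assms(1) unfolding invertible_operator_def by blast
qed

lemma bounded_clinear_minus_scaleC: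
  assumes "bounded_clinear T"
  shows "bounded_clinear (\<lambda>x. T x - z *\<^sub>C x)"
proof -
  interpret bounded_clinear T by fact
  obtain K where K: "\<And>x. norm (T x) \<le> norm x * K" using bounded by blast
  show ?thesis
  proof (unfold_locales)
    show "T (x + y) - z *\<^sub>C (x + y) = (T x - z *\<^sub>C x) + (T y - z *\<^sub>C y)" for x y
      by (simp add: add scaleC_add_right)
    show "T (r *\<^sub>R x) - z *\<^sub>C r *\<^sub>R x = r *\<^sub>R (T x - z *\<^sub>C x)" for r x
      by (simp add: scaleR_scaleC scaleC scaleC_diff_right scaleC_scaleC mult.commute)
    show "T (a *\<^sub>C x) - z *\<^sub>C a *\<^sub>C x = a *\<^sub>C (T x - z *\<^sub>C x)" for a x
      by (simp add: scaleC scaleC_diff_right scaleC_scaleC mult.commute)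
    have "norm (T x - z *\<^sub>C x) \<le> norm x * (K + cmod z)" for x
      using norm_triangle_ineq4[of "T x" "z *\<^sub>C x"] K[of x]
      by (simp add: norm_scaleC algebra_simps)
    then show "\<exists>K. \<forall>x. norm (T x - z *\<^sub>C x) \<le> norm x * K" by blast
  qed
qed

text \<open>Each point of the circle has its own lower bound. Were there no common one, unimodular w
  n with bounds tending to 0 would accumulate at some \<omega>, where the lower bound would
  fail.\<close>

lemma hyperbolic_imp_uniform_circle_resolvent:
  fixes T :: "'a::complex_normed_vector \<Rightarrow> 'a"
  assumes "bounded_clinear T" "hyperbolic T"
  obtains c where "uniform_circle_resolvent T c"
proof -
  interpret bounded_clinear T by fact
  have inv: "invertible_operator (\<lambda>x. T x - inverse \<omega> *\<^sub>C x)" if "cmod \<omega> = 1" for \<omega>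
    using assms(2) that by (auto simp: hyperbolic_def spectrum_def norm_inverse disjoint_iff)
  \<comment> \<open>The spectrum speaks of T - z, the geometric sums of 1 - \<omega> T; for z =
    1/\<omega> they differ by a unimodular scalar.\<close>
  have factor: "x - \<omega> *\<^sub>C T x = (- \<omega>) *\<^sub>C (T x - inverse \<omega> *\<^sub>C x)" if "cmod \<omega> = 1" for \<omega> x
  proof -
    have "\<omega> \<noteq> 0" using that by auto
    then have "(- \<omega>) *\<^sub>C (T x - inverse \<omega> *\<^sub>C x) = (- \<omega>) *\<^sub>C T x + x"
      unfolding scaleC_diff_right scaleC_scaleC using scaleC_diff_left[of 0 1 x]
      by (simp add: scaleC_one)
    moreover have "(- \<omega>) *\<^sub>C T x = - (\<omega> *\<^sub>C T x)"
      using scaleC_diff_left[of 0 \<omega> "T x"] by simp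
    ultimately show ?thesis by simp
  qed
  have onto: "\<exists>z. z - \<omega> *\<^sub>C T z = x" if "cmod \<omega> = 1" for \<omega> x
  proof -
    have "surj (\<lambda>x. T x - inverse \<omega> *\<^sub>C x)"
      by (rule bij_is_surj[OF invertible_operatorD(2)[OF inv[OF that]]])
    from surjD[OF this, of "inverse (- \<omega>) *\<^sub>C x"]
    obtain z where "T z - inverse \<omega> *\<^sub>C z = inverse (- \<omega>) *\<^sub>C x"
      by auto
    moreover have "(- \<omega>) * inverse (- \<omega>) = 1"
      by (rule right_inverse) (use that in auto)
    ultimately have "z - \<omega> *\<^sub>C T z = x"
      by (simp only: factor[OF that] scaleC_scaleC scaleC_one)
    then show ?thesis ..
  qed
  have lower: "\<exists>c>0. \<forall>x. c * norm x \<le> norm (x - \<omega> *\<^sub>C T x)" if \<omega>: "cmod \<omega> = 1" for \<omega>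
  proof -
    obtain K where "K > 0" "\<And>x. norm x \<le> K * norm (T x - inverse \<omega> *\<^sub>C x)"
      using invertible_operatorD(3)[OF inv[OF \<omega>]] by blast
    then show ?thesis
      unfolding factor[OF \<omega>] norm_scaleC norm_minus_cancel \<omega>
      by (intro exI[of _ "inverse K"]) (simp add: field_simps)
  qed
  have "\<exists>c>0. \<forall>\<omega> x. cmod \<omega> = 1 \<longrightarrow> c * norm x \<le> norm (x - \<omega> *\<^sub>C T x)"
  proof (rule ccontr)
    assume "\<not> ?thesis"
    then have "\<exists>\<omega> x. cmod \<omega> = 1 \<and> norm (x - \<omega> *\<^sub>C T x) < inverse (real (Suc n)) * norm x" for n
      by (metis inverse_positive_iff_positive not_le of_nat_0_less_iff zero_less_Suc)
    then obtain w x where w: "\<And>n. cmod (w n) = 1"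
      and x: "\<And>n. norm (x n - w n *\<^sub>C T (x n)) < inverse (real (Suc n)) * norm (x n)"
      by metis
    have "compact (sphere 0 1 :: complex set)" by simp
    moreover have "\<forall>n. w n \<in> sphere 0 1" using w by simp
    ultimately obtain \<omega> r where \<omega>: "\<omega> \<in> sphere 0 1" and r: "strict_mono (r::nat\<Rightarrow>nat)" and lim: "(w \<circ> r) \<longlonglongrightarrow> \<omega>"
      unfolding compact_eq_seq_compact_metric seq_compact_def by metis
    obtain c where c: "c > 0" "\<And>x. c * norm x \<le> norm (x - \<omega> *\<^sub>C T x)"
      using lower[of \<omega>] \<omega> by auto
    obtain K where K: "K \<ge> 0" "\<And>x. norm (T x) \<le> norm x * K" using nonneg_bounded by blast
    \<comment> \<open>Replacing \<open>w (r n)\<close> by \<omega> costs at most the distance of the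
      two times K times the norm of the vector. The right-hand side tends to 0, against c >
      0.\<close>
    have "c \<le> inverse (real (Suc (r n))) + cmod (w (r n) - \<omega>) * K" for n
    proof -
      define y \<nu> where "y = x (r n)" and "\<nu> = w (r n)"
      have y: "norm (y - \<nu> *\<^sub>C T y) < inverse (real (Suc (r n))) * norm y"
        using x[of "r n"] by (simp add: y_def \<nu>_def)
      then have "y \<noteq> 0" by (auto simp: zero)
      have "y - \<omega> *\<^sub>C T y = (y - \<nu> *\<^sub>C T y) + (\<nu> - \<omega>) *\<^sub>C T y"
        by (simp add: scaleC_diff_left)
      then have "norm (y - \<omega> *\<^sub>C T y) \<le> norm (y - \<nu> *\<^sub>C T y) + cmod (\<nu> - \<omega>) * norm (T y)"
        by (metis norm_triangle_ineq norm_scaleC)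
      also have "cmod (\<nu> - \<omega>) * norm (T y) \<le> cmod (\<nu> - \<omega>) * (norm y * K)"
        by (intro mult_left_mono K) simp
      finally have "c * norm y \<le> (inverse (real (Suc (r n))) + cmod (\<nu> - \<omega>) * K) * norm y"
        using c(2)[of y] y by (simp add: algebra_simps)
      then show ?thesis using \<open>y \<noteq> 0\<close> by (simp add: \<nu>_def)
    qed
    moreover have "(\<lambda>n. inverse (real (Suc (r n))) + cmod (w (r n) - \<omega>) * K) \<longlonglongrightarrow> 0 + cmod (\<omega> - \<omega>) * K"
      using LIMSEQ_subseq_LIMSEQ[OF LIMSEQ_inverse_real_of_nat r] lim
      by (intro tendsto_intros) (simp_all add: o_def)
    ultimately have "c \<le> 0 + cmod (\<omega> - \<omega>) * K"
      by (intro LIMSEQ_le_const) auto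
    then show False using c(1) by simp
  qed
  then obtain c where "c > 0" "\<And>\<omega> x. cmod \<omega> = 1 \<Longrightarrow> c * norm x \<le> norm (x - \<omega> *\<^sub>C T x)"
    by blast
  then have "uniform_circle_resolvent T c"
    by unfold_locales (auto intro: onto)
  then show thesis by (rule that)
qed

section \<open>Hyperbolicity implies both conditions\<close>

lemma homoclinic_imp_bounded_orbit:
  assumes "homoclinic r T x"
  obtains b where "\<And>n::int. norm (zpow T n x) \<le> b"
proof -
  obtain N where N: "\<And>n. \<bar>n\<bar> \<ge> int N \<Longrightarrow> norm (zpow T n x) \<le> r"
    using assms unfolding homoclinic_def by blast
  define M where "M = Max ((\<lambda>n. norm (zpow T n x)) ` {- int N..int N})"
  have "norm (zpow T n x) \<le> max r M" for n
  proof (cases "\<bar>n\<bar> \<ge> int N")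
    case False
    then have "norm (zpow T n x) \<le> M" unfolding M_def by (intro Max_ge imageI) auto
    then show ?thesis by simp
  qed (use N in \<open>auto simp: le_max_iff_disj\<close>)
  then show thesis by (rule that)
qed

text \<open>Subtracting from the pseudo-orbit a bounded solution \<open>v\<close> with the same
  error leaves an exact orbit, at distance the norm of \<open>v\<close>.\<close>

lemma hyperbolic_imp_shadowing:
  fixes T :: "'a::complex_banach \<Rightarrow> 'a"
  assumes "invertible_operator T" "hyperbolic T"
  shows "shadowing_property T"
  unfolding shadowing_property_def
proof (intro allI impI)
  fix \<epsilon> :: real assume "\<epsilon> > 0"
  obtain c where "uniform_circle_resolvent T c"
    using hyperbolic_imp_uniform_circle_resolvent[OF invertible_operatorD(1)] assms by blast
  then interpret banach_uniform_circle_resolvent T c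
    by (simp add: banach_uniform_circle_resolvent_def)
  obtain C where C: "C \<ge> 0"
    "\<And>z b. (\<And>n. norm (z n) \<le> b) \<Longrightarrow>
      \<exists>v. (\<forall>n::int. v (n + 1) - T (v n) = z n) \<and> (\<forall>n. norm (v n) \<le> C * b)"
    using bounded_solution by blast
  \<comment> \<open>The denominator C + 1 covers C = 0 and makes C \<delta> < \<epsilon>
    strict.\<close>
  define \<delta> where "\<delta> = \<epsilon> / (C + 1)"
  have \<delta>: "\<delta> > 0" "C * \<delta> < \<epsilon>"
    using C(1) \<open>\<epsilon> > 0\<close> by (simp_all add: \<delta>_def field_simps)
  show "\<exists>\<delta>>0. \<forall>x. (\<forall>n. norm (T (x n) - x (n + 1)) < \<delta>) \<longrightarrow> (\<exists>y. \<forall>n. norm (zpow T n y - x n) < \<epsilon>)"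
  proof (intro exI[of _ \<delta>] conjI allI impI)
    fix x :: "int \<Rightarrow> 'a" assume "\<forall>n. norm (T (x n) - x (n + 1)) < \<delta>"
    then have "norm (x (n + 1) - T (x n)) \<le> \<delta>" for n
      by (metis norm_minus_commute less_imp_le)
    from C(2)[of "\<lambda>n. x (n + 1) - T (x n)", OF this]
    obtain v where v: "\<And>n. v (n + 1) - T (v n) = x (n + 1) - T (x n)" "\<And>n. norm (v n) \<le> C * \<delta>"
      by blast
    have "x (n + 1) - v (n + 1) = T (x n - v n)" for n
      using v(1)[of n] by (simp add: diff algebra_simps)
    then have "zpow T n (x 0 - v 0) = x n - v n" for n
      by (rule orbit_eq_zpow[OF invertible_operatorD(2)[OF assms(1)], symmetric])
    then have "norm (zpow T n (x 0 - v 0) - x n) = norm (v n)" for n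
      by simp
    then have "norm (zpow T n (x 0 - v 0) - x n) < \<epsilon>" for n
      using v(2)[of n] \<delta>(2) by simp
    then show "\<exists>y. \<forall>n. norm (zpow T n y - x n) < \<epsilon>" by blast
  qed (fact \<delta>)
qed

lemma hyperbolic_imp_no_homoclinic:
  fixes T :: "'a::complex_normed_vector \<Rightarrow> 'a"
  assumes "invertible_operator T" "hyperbolic T" "homoclinic r T x"
  shows "x = 0"
proof -
  obtain c where "uniform_circle_resolvent T c"
    using hyperbolic_imp_uniform_circle_resolvent[OF invertible_operatorD(1)] assms by blast
  then interpret uniform_circle_resolvent T c .
  obtain b where "\<And>n. norm (zpow T n x) \<le> b"
    using homoclinic_imp_bounded_orbit[OF assms(3)] by blast
  then have "zpow T 0 x = 0"
    by (rule bounded_orbit_eq_0[of "\<lambda>n. zpow T n x", OF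
          zpow_Suc[OF bij_is_surj[OF invertible_operatorD(2)[OF assms(1)]]]])
  then show ?thesis by (simp add: zpow_0)
qed

section \<open>The converse implication\<close>

lemma shadowing_imp_hyperbolic:
  fixes T :: "'a::complex_normed_vector \<Rightarrow> 'a"
  assumes "invertible_operator T" and shadow: "shadowing_property T"
    and hom: "\<And>r x. r > 0 \<Longrightarrow> homoclinic r T x \<Longrightarrow> x = 0"
  shows "hyperbolic T"
proof -
  interpret bounded_clinear T by (rule invertible_operatorD(1)[OF assms(1)])
  note bij = invertible_operatorD(2)[OF assms(1)]
  have unique: "u n = 0" if u: "\<And>n. u (n + 1) = T (u n)" "\<And>n. norm (u n) \<le> b" for u :: "int \<Rightarrow> 'a" and n b
  proof -
    have u_zpow: "u n = zpow T n (u 0)" for n by (rule orbit_eq_zpow[of T u, OF bij u(1)])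
    \<comment> \<open>A bounded orbit is homoclinic already with N = 0; the added 1 keeps the radius
      positive, as \<open>hom\<close> requires.\<close>
    then have "homoclinic (\<bar>b\<bar> + 1) T (u 0)"
      unfolding homoclinic_def using u(2) by (intro exI[of _ 0]) (smt (verit))
    then have "u 0 = 0" by (intro hom[of "\<bar>b\<bar> + 1"]) simp_all
    then have "norm (zpow T n (u 0)) \<le> 0"
      using orbit_eq_zpow[of T "\<lambda>_. 0", OF bij] by (simp add: zero)
    then show ?thesis unfolding u_zpow[of n] by simp
  qed
  obtain \<delta> where \<delta>: "\<delta> > 0" "\<And>x. (\<And>n. norm (T (x n) - x (n + 1)) < \<delta>) \<Longrightarrow>
      \<exists>y. \<forall>n. norm (zpow T n y - x n) < 1"
    using shadow zero_less_one unfolding shadowing_property_def by metis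
  \<comment> \<open>A pseudo-orbit with error \<open>z\<close> minus the orbit shadowing it at scale
    1 still has error \<open>z\<close>, and is bounded by 1.\<close>
  have solve: "\<exists>u. (\<forall>n. u (n + 1) - T (u n) = z n) \<and> (\<forall>n. norm (u n) < 1)"
    if z: "\<And>n. norm (z n) < \<delta>" for z :: "int \<Rightarrow> 'a"
  proof -
    obtain x where x: "\<And>n. x (n + 1) - T (x n) = z n"
      using ex_pseudo_orbit[OF bij_is_surj[OF bij]] by blast
    have "norm (T (x n) - x (n + 1)) < \<delta>" for n
      using z[of n] x[of n] by (metis norm_minus_commute)
    then obtain y where y: "\<And>n. norm (zpow T n y - x n) < 1" using \<delta>(2) by blast
    show ?thesis
    proof (intro exI[of _ "\<lambda>n. x n - zpow T n y"] conjI allI)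
      show "x (n + 1) - zpow T (n + 1) y - T (x n - zpow T n y) = z n" for n
        using x[of n] unfolding zpow_Suc[OF bij_is_surj[OF bij]] diff by (simp add: algebra_simps)
      show "norm (x n - zpow T n y) < 1" for n using y[of n] by (simp add: norm_minus_commute)
    qed
  qed
  have "invertible_operator (\<lambda>x. T x - \<omega> *\<^sub>C x)" if \<omega>: "cmod \<omega> = 1" for \<omega>
  proof (rule invertible_operatorI)
    show "bounded_clinear (\<lambda>x. T x - \<omega> *\<^sub>C x)"
      by (rule bounded_clinear_minus_scaleC) unfold_locales
    have "\<omega> \<noteq> 0" using \<omega> by auto
    then have pi: "\<omega> powi (n + 1) = \<omega> * \<omega> powi n" "cmod (\<omega> powi n) = 1" for n
      using \<omega> power_int_add[of \<omega> n 1] by (auto simp: norm_power_int mult.commute)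
    show "x = 0" if "T x - \<omega> *\<^sub>C x = 0" for x
    proof -
      \<comment> \<open>An eigenvector for \<omega> generates the bounded orbit \<omega>^n
        x.\<close>
      have "(\<omega> powi (n + 1)) *\<^sub>C x = T ((\<omega> powi n) *\<^sub>C x)" for n
        using that by (simp add: pi scaleC scaleC_scaleC mult.commute)
      then have "(\<omega> powi 0) *\<^sub>C x = 0"
        by (rule unique[of "\<lambda>n. (\<omega> powi n) *\<^sub>C x" "norm x"]) (simp add: norm_scaleC pi)
      then show ?thesis by (simp add: scaleC_one)
    qed
    have small: "\<exists>x. T x - \<omega> *\<^sub>C x = y \<and> norm x \<le> 1" if y: "norm y < \<delta>" for y
    proof -
      obtain u where u: "\<And>n. u (n + 1) - T (u n) = (\<omega> powi n) *\<^sub>C (- y)" "\<And>n. norm (u n) < 1"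
        using solve[of "\<lambda>n. (\<omega> powi n) *\<^sub>C (- y)"] y by (auto simp: norm_scaleC pi)
      \<comment> \<open>\<open>d\<close> measures the failure of u(n + 1) = \<omega> u(n). The
        right-hand side has this symmetry, so \<open>d\<close> is a bounded orbit and vanishes; the
        sign of \<open>- y\<close> then gives T u(0) - \<omega> u(0) = y.\<close>
      define d where "d n = u (n + 1) - \<omega> *\<^sub>C u n" for n
      have "d (n + 1) = T (d n)" for n
      proof -
        have "d (n + 1) - T (d n) = (u (n + 1 + 1) - T (u (n + 1))) - \<omega> *\<^sub>C (u (n + 1) - T (u n))"
          by (simp add: d_def diff scaleC scaleC_diff_right)
        also have "\<dots> = 0" unfolding u(1) by (simp add: pi scaleC_scaleC)
        finally show ?thesis by simp
      qed
      moreover have "norm (d n) \<le> 2" for n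
        using norm_triangle_ineq4[of "u (n + 1)" "\<omega> *\<^sub>C u n"] u(2)[of n] u(2)[of "n + 1"]
        by (simp add: d_def norm_scaleC \<omega>)
      ultimately have "d 0 = 0" by (rule unique)
      then have "T (u 0) - \<omega> *\<^sub>C u 0 = y"
        using u(1)[of 0] by (simp add: d_def scaleC_one algebra_simps)
      then show ?thesis using u(2)[of 0] by (intro exI[of _ "u 0"]) simp
    qed
    show "\<exists>x. T x - \<omega> *\<^sub>C x = y \<and> norm x \<le> (2 / \<delta>) * norm y" for y
    proof (cases "y = 0")
      case True
      then show ?thesis by (intro exI[of _ 0]) (simp add: zero)
    next
      case False
      \<comment> \<open>Rescaling \<open>y\<close> to norm \<delta>/2 brings it within reach of
        \<open>small\<close>; undoing it gives the factor 1/s, hence the constant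
        2/\<delta>.\<close>
      define s where "s = \<delta> / (2 * norm y)"
      have s: "s > 0" "norm (s *\<^sub>R y) < \<delta>" using False \<delta>(1) by (simp_all add: s_def)
      from small[OF s(2)] obtain x where x: "T x - \<omega> *\<^sub>C x = s *\<^sub>R y" "norm x \<le> 1" by blast
      have "T (inverse s *\<^sub>R x) - \<omega> *\<^sub>C inverse s *\<^sub>R x = inverse s *\<^sub>R (T x - \<omega> *\<^sub>C x)"
        by (simp add: scaleR_scaleC scaleC scaleC_diff_right scaleC_scaleC mult.commute)
      also have "\<dots> = y" using s(1) x(1) by simp
      finally show ?thesis
        using x(2) s(1) False \<delta>(1)
        by (intro exI[of _ "inverse s *\<^sub>R x"]) (simp add: s_def field_simps)
    qed
  qed
  then show ?thesis by (auto simp: hyperbolic_def spectrum_def)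
qed

theorem mainTheorem2:
  fixes T :: "'a::complex_banach \<Rightarrow> 'a"
  assumes "invertible_operator T"
  shows "hyperbolic T \<longleftrightarrow>
    shadowing_property T \<and> (\<forall>r>0. \<not> (\<exists>x. x \<noteq> 0 \<and> homoclinic r T x))"
  using hyperbolic_imp_shadowing[OF assms] hyperbolic_imp_no_homoclinic[OF assms]
    shadowing_imp_hyperbolic[OF assms] by blast

end
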